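(* Let $N\in\mathbb{N}$ and let $r_1,r_2$ be integers with $\gcd(r_1,r_2,N)=1$. Then the solutions $(x,y)\in(\mathbb{Z}/N\mathbb{Z})^2$ of the linear congruence $r_1x+r_2y\equiv 0 \bmod N$ are of the form $(x,y)=k\cdot(r_2,-r_1)$ with $k\in\mathbb{Z}/N\mathbb{Z}$; that is, $$\{(x,y)\in(\mathbb{Z}/N\mathbb{Z})^2: r_1x+r_2y\equiv 0\bmod N\}=\{k\cdot(r_2,-r_1): k\in\mathbb{Z}/N\mathbb{Z}\}.$$ *)

theory Defs
  imports "HOL-Algebra.IntRing"
begin

text \<open>The ring of integers modulo \<open>N\<close> is the quotient ring \<^term>\<open>ZFact (int N)\<close>, whose elements
  are the cosets of the ideal generated by \<open>N\<close>.\<close>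

definition zmod_class :: "nat \<Rightarrow> int \<Rightarrow> int set"
  where "zmod_class N a = (Idl\<^bsub>int_ring\<^esub> {int N}) +>\<^bsub>int_ring\<^esub> a"

lemma zmod_class_ring_hom: "zmod_class N \<in> ring_hom int_ring (ZFact (int N))"
proof -
  interpret ideal "Idl\<^bsub>int_ring\<^esub> {int N}" int_ring
    by (rule int.genideal_ideal) simp
  show ?thesis
    using rcos_ring_hom by (simp add: ZFact_def zmod_class_def [abs_def])
qed

lemma carrier_ZFact_eq: "carrier (ZFact (int N)) = range (zmod_class N)"
  by (auto simp: ZFact_def FactRing_def A_RCOSETS_defs a_r_coset_def r_coset_def zmod_class_def)

lemma zmod_class_eq: "zmod_class N a = {b. b mod int N = a mod int N}"
proof -
  have "b \<in> zmod_class N a \<longleftrightarrow> (\<exists>h. b = h * int N + a)" for b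
    by (auto simp: zmod_class_def a_r_coset_def r_coset_def int_Idl)
  also have "(\<exists>h. b = h * int N + a) \<longleftrightarrow> int N dvd b - a" for b
    by (auto simp: dvd_def algebra_simps)
  finally show ?thesis
    by (auto simp: mod_eq_dvd_iff)
qed

end

theory Submission
  imports Defs
begin

text \<open>With a Bezout relation \<open>u * r1 + v * r2 \<equiv> 1\<close> modulo \<open>N\<close>, a solution \<open>(x, y)\<close> of the congruence
  is the multiple of \<open>(r2, - r1)\<close> by \<open>k = v * x - u * y\<close>.\<close>

text \<open>Moves questions about cosets to divisibility in the integers. For \<open>N = 0\<close>
  both sides mean \<open>a = b\<close>, so that modulus needs no separate case.\<close>

lemma zmod_class_eq_iff: "zmod_class N a = zmod_class N b \<longleftrightarrow> int N dvd a - b"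
  by (auto simp: zmod_class_eq simp flip: mod_eq_dvd_iff)

lemma zmod_class_mult:
  "zmod_class N a \<otimes>\<^bsub>ZFact (int N)\<^esub> zmod_class N b = zmod_class N (a * b)"
  using ring_hom_mult[OF zmod_class_ring_hom] by simp

lemma zmod_class_add:
  "zmod_class N a \<oplus>\<^bsub>ZFact (int N)\<^esub> zmod_class N b = zmod_class N (a + b)"
  using ring_hom_add[OF zmod_class_ring_hom] by simp

lemma zmod_class_zero: "\<zero>\<^bsub>ZFact (int N)\<^esub> = zmod_class N 0"
  using ring_hom_zero[OF zmod_class_ring_hom int_is_cring[THEN cring.axioms(1)]
      ZFact_is_cring[THEN cring.axioms(1)]] by simp

text \<open>The two-term identity is applied twice, to \<open>b\<close>, \<open>c\<close> and then
  to \<open>a\<close>, \<open>gcd b c\<close>, because the triple gcd is the nested one.\<close>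

lemma bezout3_int:
  fixes a b c :: int
  assumes "Gcd {a, b, c} = 1"
  obtains u v w where "u * a + v * b + w * c = 1"
proof -
  obtain p q where pq: "p * b + q * c = gcd b c"
    using bezout_int by blast
  obtain u s where "u * a + s * gcd b c = gcd a (gcd b c)"
    using bezout_int by blast
  then have "u * a + s * (p * b + q * c) = 1"
    using assms pq by simp
  then have "u * a + (s * p) * b + (s * q) * c = 1"
    by (simp add: algebra_simps)
  then show thesis by (rule that)
qed

text \<open>The arithmetic core, stated for integer representatives; the theorem only translates it
  to the quotient ring.\<close>

lemma dvd_lincomb_iff:
  fixes n r1 r2 x y :: int
  assumes "Gcd {r1, r2, n} = 1"
  shows "n dvd r1 * x + r2 * y \<longleftrightarrow> (\<exists>k. n dvd x - k * r2 \<and> n dvd y - k * (- r1))"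
proof
  assume "n dvd r1 * x + r2 * y"
  then obtain t where t: "r1 * x + r2 * y = n * t" ..
  obtain u v w where uvw: "u * r1 + v * r2 + w * n = 1"
    using bezout3_int[OF assms] .
  \<comment> \<open>Multiplying \<open>x\<close> by the Bezout sum, which is 1, makes the two
    \<open>v * x * r2\<close> terms cancel; what is left is a multiple of \<open>n\<close> plus
    \<open>u\<close> times the given linear form.\<close>
  have "x - (v * x - u * y) * r2 = x * (u * r1 + v * r2 + w * n) - (v * x - u * y) * r2"
    using uvw by simp
  also have "\<dots> = n * (w * x) + u * (r1 * x + r2 * y)"
    by (simp add: algebra_simps)
  also have "\<dots> = n * (w * x + u * t)"
    unfolding t by (simp add: algebra_simps)
  finally have x: "x - (v * x - u * y) * r2 = n * (w * x + u * t)" .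
  \<comment> \<open>The same \<open>k\<close> serves the second coordinate: now the
    \<open>u * y * r1\<close> terms cancel and \<open>v\<close> times the linear form
    remains.\<close>
  have "y - (v * x - u * y) * (- r1)
      = y * (u * r1 + v * r2 + w * n) - (v * x - u * y) * (- r1)"
    using uvw by simp
  also have "\<dots> = n * (w * y) + v * (r1 * x + r2 * y)"
    by (simp add: algebra_simps)
  also have "\<dots> = n * (w * y + v * t)"
    unfolding t by (simp add: algebra_simps)
  finally have "y - (v * x - u * y) * (- r1) = n * (w * y + v * t)" .
  with x show "\<exists>k. n dvd x - k * r2 \<and> n dvd y - k * (- r1)"
    by (metis dvd_triv_left)
next
  assume "\<exists>k. n dvd x - k * r2 \<and> n dvd y - k * (- r1)"
  then obtain k where "n dvd x - k * r2" "n dvd y - k * (- r1)" by blast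
  \<comment> \<open>The contributions of \<open>k\<close> cancel, since the linear form vanishes at
    \<open>(r2, - r1)\<close>.\<close>
  then have "n dvd r1 * (x - k * r2) + r2 * (y - k * (- r1))"
    by (intro dvd_add dvd_mult)
  then show "n dvd r1 * x + r2 * y"
    by (simp add: algebra_simps)
qed

theorem proposition3:
  fixes N :: nat and r1 r2 :: int
  assumes "Gcd {r1, r2, int N} = 1"
  shows
    "{(x, y). x \<in> carrier (ZFact (int N)) \<and> y \<in> carrier (ZFact (int N)) \<and>
        (zmod_class N r1 \<otimes>\<^bsub>ZFact (int N)\<^esub> x) \<oplus>\<^bsub>ZFact (int N)\<^esub>
          (zmod_class N r2 \<otimes>\<^bsub>ZFact (int N)\<^esub> y) = \<zero>\<^bsub>ZFact (int N)\<^esub>} =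
     {(k \<otimes>\<^bsub>ZFact (int N)\<^esub> zmod_class N r2, k \<otimes>\<^bsub>ZFact (int N)\<^esub> zmod_class N (- r1)) |k.
        k \<in> carrier (ZFact (int N))}"
    (is "?S = ?T")
proof -
  \<comment> \<open>Every ring element is the class of an integer, so both sets can be parametrised
    by integers.\<close>
  have S: "?S = {(zmod_class N a, zmod_class N b) |a b. int N dvd r1 * a + r2 * b}"
  proof -
    have "zmod_class N r1 \<otimes>\<^bsub>ZFact (int N)\<^esub> zmod_class N a \<oplus>\<^bsub>ZFact (int N)\<^esub>
        zmod_class N r2 \<otimes>\<^bsub>ZFact (int N)\<^esub> zmod_class N b = \<zero>\<^bsub>ZFact (int N)\<^esub>
        \<longleftrightarrow> int N dvd r1 * a + r2 * b" for a b
      by (simp add: zmod_class_mult zmod_class_add zmod_class_zero zmod_class_eq_iff)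
    then show ?thesis
      unfolding carrier_ZFact_eq by blast
  qed
  have T: "?T = {(zmod_class N (k * r2), zmod_class N (k * (- r1))) |k. True}"
    \<comment> \<open>Read backwards, the product rule splits the classes on the right into products
      with the class of \<open>k\<close>, matching \<open>?T\<close>.\<close>
    unfolding carrier_ZFact_eq zmod_class_mult[symmetric] by blast
  show ?thesis
  proof (intro subset_antisym subsetI)
    fix p assume "p \<in> ?S"
    then obtain a b where p: "p = (zmod_class N a, zmod_class N b)"
      and "int N dvd r1 * a + r2 * b"
      unfolding S by blast
    then obtain k where "int N dvd a - k * r2" "int N dvd b - k * (- r1)"
      using dvd_lincomb_iff[OF assms] by blast
    then have "p = (zmod_class N (k * r2), zmod_class N (k * (- r1)))"
      unfolding p by (simp only: zmod_class_eq_iff prod.inject simp_thms)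
    then show "p \<in> ?T"
      unfolding T by blast
  next
    fix p assume "p \<in> ?T"
    then obtain k where p: "p = (zmod_class N (k * r2), zmod_class N (k * (- r1)))"
      unfolding T by blast
    have "int N dvd r1 * (k * r2) + r2 * (k * (- r1))"
      by (simp add: algebra_simps)
    then show "p \<in> ?S"
      unfolding S p by blast
  qed
qed

end
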